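(* Let $\alpha_0,\alpha_1,\alpha_2,\eta$ be complex parameters with $\alpha_0+\alpha_1+\alpha_2=1$. The system $$\begin{aligned} \frac{dq_1}{ds}&=-\frac{q_1^2p_1}{s}+\frac{\alpha_2q_1}{s}-\frac{p_2}{s},\\ \frac{dp_1}{ds}&=\frac{q_1p_1^2}{s}-\frac{\alpha_2p_1}{s}-\frac{1}{2s},\\ \frac{dq_2}{ds}&=-\frac{q_2^2p_2}{s}-\frac{(\alpha_1+\alpha_2)q_2}{s}-\frac{p_1}{s},\\ \frac{dp_2}{ds}&=\frac{q_2p_2^2}{s}+\frac{(\alpha_1+\alpha_2)p_2}{s}+\frac{\eta}{2} \end{aligned}$$ admits extended affine Weyl group symmetry of type $D_3^{(2)}$ as the group of its Bäcklund transformations, whose generators $s_0,s_1,s_2,\pi$ are defined as follows, with the notation $( * ):=(q_1,p_1,q_2,p_2,\eta,s;\alpha_0,\alpha_1,\alpha_2)$: $$s_0:( * )\mapsto\left(q_1,\;p_1,\;q_2-\frac{2\alpha_0}{p_2}+\frac{\eta s}{p_2^2},\;p_2,\;\eta,\;-s;\;-\alpha_0,\;\alpha_1+2\alpha_0,\;\alpha_2\right),$$ $$s_1:( * )\mapsto\left(q_1,\;p_1+\frac{\alpha_1q_2}{q_1q_2+1},\;q_2,\;p_2+\frac{\alpha_1q_1}{q_1q_2+1},\;\eta,\;s;\;\alpha_0+\alpha_1,\;-\alpha_1,\;\alpha_2+\alpha_1\right),$$ $$s_2:( * )\mapsto\left(-q_1+\frac{2\alpha_2}{p_1}+\frac{1}{p_1^2},\;-p_1,\;-q_2,\;-p_2,\;\eta,\;-s;\;\alpha_0,\;\alpha_1+2\alpha_2,\;-\alpha_2\right),$$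 $$\pi:( * )\mapsto\left(-\eta sq_2,\;-\frac{p_2}{\eta s},\;-\frac{q_1}{\eta s},\;-\eta sp_1,\;\eta,\;s;\;\alpha_2,\;\alpha_1,\;\alpha_0\right),$$ where $\pi$ is the diagram automorphism of the Dynkin diagram of type $D_3^{(2)}$.
   Context: Here $q_1,p_1,q_2,p_2$ are unknown complex functions of the complex variable $s$. A Bäcklund transformation of the system is a birational transformation of the variables (possibly including the independent variable $s$), together with a transformation of the parameters, that carries the system to the system of the same form with the transformed variables and parameters. For $\pi$ to be defined one needs $\eta\neq0$. The affine Weyl group of type $D_3^{(2)}$ is the Coxeter group with generators $s_0,s_1,s_2$ and defining relations $s_0^2=s_1^2=s_2^2=1$, $(s_0s_2)^2=1$, $(s_0s_1)^4=1$, $(s_1s_2)^4=1$; the extended affine Weyl group is obtained by adjoining $\pi$ with $\pi^2=1$, $\pi s_0=s_2\pi$, $\pi s_1=s_1\pi$. The claim means that $s_0,s_1,s_2,\pi$ are Bäcklund transformations of the system and satisfy these relations. *)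

theory Defs
  imports "HOL-Analysis.Analysis"
begin

section \<open>The system\<close>

text \<open>A point of the phase space is (q1, p1, q2, p2, s), a parameter value is
  (eta, alpha0, alpha1, alpha2). The tuple written (q1, p1, q2, p2, eta, s; alpha0, alpha1, alpha2)
  in the mathematics is the pair of the two.\<close>

type_synonym vars = "complex \<times> complex \<times> complex \<times> complex \<times> complex"
type_synonym params = "complex \<times> complex \<times> complex \<times> complex"

definition normalized :: "params set" where
  "normalized = {(\<eta>, \<alpha>0, \<alpha>1, \<alpha>2). \<alpha>0 + \<alpha>1 + \<alpha>2 = 1}"

definition nonzero_eta :: "params set" where
  "nonzero_eta = {(\<eta>, \<alpha>0, \<alpha>1, \<alpha>2). \<eta> \<noteq> 0}"

type_synonym curve =
  "(complex \<Rightarrow> complex) \<times> (complex \<Rightarrow> complex) \<times> (complex \<Rightarrow> complex) \<times> (complex \<Rightarrow> complex)"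

text \<open>Holomorphic solutions on an open set. The point 0, at which the equations are not defined,
  has to be excluded explicitly because x / 0 = 0 in HOL.\<close>

definition solution :: "params \<Rightarrow> complex set \<Rightarrow> curve \<Rightarrow> bool" where
  "solution = (\<lambda>(\<eta>, \<alpha>0, \<alpha>1, \<alpha>2) U (q1, p1, q2, p2).
     open U \<and> 0 \<notin> U \<and>
     (\<forall>s\<in>U.
       (q1 has_field_derivative
          (- ((q1 s)\<^sup>2 * p1 s / s) + \<alpha>2 * q1 s / s - p2 s / s)) (at s) \<and>
       (p1 has_field_derivative
          (q1 s * (p1 s)\<^sup>2 / s - \<alpha>2 * p1 s / s - 1 / (2 * s))) (at s) \<and>
       (q2 has_field_derivative
          (- ((q2 s)\<^sup>2 * p2 s / s) - (\<alpha>1 + \<alpha>2) * q2 s / s - p1 s / s)) (at s) \<and>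
       (p2 has_field_derivative
          (q2 s * (p2 s)\<^sup>2 / s + (\<alpha>1 + \<alpha>2) * p2 s / s + \<eta> / 2)) (at s)))"

definition graph :: "complex set \<Rightarrow> curve \<Rightarrow> vars set" where
  "graph = (\<lambda>U (q1, p1, q2, p2). (\<lambda>s. (q1 s, p1 s, q2 s, p2 s, s)) ` U)"


section \<open>Rational maps\<close>

text \<open>Rational maps are represented by honest partial maps, undefined where a denominator
  vanishes, and are compared on nonempty Zariski open sets.\<close>

inductive poly_fun :: "(vars \<Rightarrow> complex) \<Rightarrow> bool" where
  const: "poly_fun (\<lambda>_. c)"
| q1: "poly_fun (\<lambda>(q1, p1, q2, p2, s). q1)"
| p1: "poly_fun (\<lambda>(q1, p1, q2, p2, s). p1)"
| q2: "poly_fun (\<lambda>(q1, p1, q2, p2, s). q2)"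
| p2: "poly_fun (\<lambda>(q1, p1, q2, p2, s). p2)"
| s: "poly_fun (\<lambda>(q1, p1, q2, p2, s). s)"
| add: "poly_fun f \<Longrightarrow> poly_fun g \<Longrightarrow> poly_fun (\<lambda>v. f v + g v)"
| mult: "poly_fun f \<Longrightarrow> poly_fun g \<Longrightarrow> poly_fun (\<lambda>v. f v * g v)"

definition generically :: "(vars \<Rightarrow> bool) \<Rightarrow> bool" where
  "generically P \<longleftrightarrow> (\<exists>d. poly_fun d \<and> (\<exists>v. d v \<noteq> 0) \<and> (\<forall>v. d v \<noteq> 0 \<longrightarrow> P v))"

definition rational_map :: "(vars \<rightharpoonup> vars) \<Rightarrow> bool" where
  "rational_map F \<longleftrightarrow>
     (\<exists>d f1 f2 f3 f4 f5. poly_fun d \<and> (\<exists>v. d v \<noteq> 0) \<and>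
        poly_fun f1 \<and> poly_fun f2 \<and> poly_fun f3 \<and> poly_fun f4 \<and> poly_fun f5 \<and>
        (\<forall>v. d v \<noteq> 0 \<longrightarrow>
           F v = Some (f1 v / d v, f2 v / d v, f3 v / d v, f4 v / d v, f5 v / d v)))"

definition birational :: "(vars \<rightharpoonup> vars) \<Rightarrow> bool" where
  "birational F \<longleftrightarrow> rational_map F \<and>
     (\<exists>G. rational_map G \<and> generically (\<lambda>v. (G \<circ>\<^sub>m F) v = Some v)
                       \<and> generically (\<lambda>v. (F \<circ>\<^sub>m G) v = Some v))"


section \<open>Baecklund transformations\<close>

type_synonym transformation = "vars \<times> params \<rightharpoonup> vars \<times> params"

definition at_params :: "transformation \<Rightarrow> params \<Rightarrow> (vars \<rightharpoonup> vars)" where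
  "at_params T a = (\<lambda>v. map_option fst (T (v, a)))"

text \<open>A map carries the system with parameters a to the one with parameters b if it maps the graph
  of every solution of the first, as long as the map is defined along it, onto the graph of a
  solution of the second. Since the independent variable is a coordinate of the graph, this
  includes its transformation.\<close>

definition carries :: "params \<Rightarrow> params \<Rightarrow> (vars \<rightharpoonup> vars) \<Rightarrow> bool" where
  "carries a b F \<longleftrightarrow>
     (\<forall>U y. solution a U y \<and> graph U y \<subseteq> dom F \<longrightarrow>
        (\<exists>V z. solution b V z \<and> graph V z = (\<lambda>v. the (F v)) ` graph U y))"

definition Backlund :: "params set \<Rightarrow> transformation \<Rightarrow> bool" where
  "Backlund A T \<longleftrightarrow>
     (\<exists>\<tau>. \<forall>a\<in>A. \<tau> a \<in> A \<and> (\<forall>v w b. T (v, a) = Some (w, b) \<longrightarrow> b = \<tau> a) \<and>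
        birational (at_params T a) \<and> carries a (\<tau> a) (at_params T a))"

text \<open>Equality as rational maps in the variables, for every single parameter value in A.\<close>

definition rat_eq :: "params set \<Rightarrow> transformation \<Rightarrow> transformation \<Rightarrow> bool" where
  "rat_eq A S T \<longleftrightarrow> (\<forall>a\<in>A. generically (\<lambda>v. S (v, a) \<noteq> None \<and> S (v, a) = T (v, a)))"

primrec power_map :: "('a \<rightharpoonup> 'a) \<Rightarrow> nat \<Rightarrow> ('a \<rightharpoonup> 'a)" where
  "power_map T 0 = Some"
| "power_map T (Suc n) = T \<circ>\<^sub>m power_map T n"


section \<open>The generators\<close>

fun s0 :: transformation where
  "s0 ((q1, p1, q2, p2, s), (\<eta>, \<alpha>0, \<alpha>1, \<alpha>2)) =
     (if p2 = 0 then None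
      else Some ((q1, p1, q2 - 2 * \<alpha>0 / p2 + \<eta> * s / p2\<^sup>2, p2, - s),
                 (\<eta>, - \<alpha>0, \<alpha>1 + 2 * \<alpha>0, \<alpha>2)))"

fun s1 :: transformation where
  "s1 ((q1, p1, q2, p2, s), (\<eta>, \<alpha>0, \<alpha>1, \<alpha>2)) =
     (if q1 * q2 + 1 = 0 then None
      else Some ((q1, p1 + \<alpha>1 * q2 / (q1 * q2 + 1), q2, p2 + \<alpha>1 * q1 / (q1 * q2 + 1), s),
                 (\<eta>, \<alpha>0 + \<alpha>1, - \<alpha>1, \<alpha>2 + \<alpha>1)))"

fun s2 :: transformation where
  "s2 ((q1, p1, q2, p2, s), (\<eta>, \<alpha>0, \<alpha>1, \<alpha>2)) =
     (if p1 = 0 then None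
      else Some ((- q1 + 2 * \<alpha>2 / p1 + 1 / p1\<^sup>2, - p1, - q2, - p2, - s),
                 (\<eta>, \<alpha>0, \<alpha>1 + 2 * \<alpha>2, - \<alpha>2)))"

fun \<pi> :: transformation where
  "\<pi> ((q1, p1, q2, p2, s), (\<eta>, \<alpha>0, \<alpha>1, \<alpha>2)) =
     (if \<eta> * s = 0 then None
      else Some ((- (\<eta> * s * q2), - (p2 / (\<eta> * s)), - (q1 / (\<eta> * s)), - (\<eta> * s * p1), s),
                 (\<eta>, \<alpha>2, \<alpha>1, \<alpha>0)))"

text \<open>Products below are compositions of maps of points. Reading the generators instead as
  substitutions in rational functions reverses all products; as the generators are involutions,
  this leaves the set of relations unchanged.\<close>

end

theory Submission
  imports Defs
begin

text \<open>
  Three things have to be shown: each generator carries solutions to solutions, each is birational,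
  and the group relations hold as identities of rational maps for every single parameter value.

  Transport of solutions is the chain rule. The maps \<open>s0\<close> and \<open>s2\<close> reverse the sign
  of \<open>s\<close>, so a solution on \<open>U\<close> goes to one on \<open>- U\<close>; once this change of
  variable is separated off (\<open>carriesI\<close>), each of the four cases is an identity between rational
  functions of the values of the solution at one point. The condition
  \<open>\<alpha>0 + \<alpha>1 + \<alpha>2 = 1\<close> enters for \<open>s0\<close> and \<open>\<pi>\<close>: it accounts for
  the derivative of the factor \<open>s\<close> in their formulas.

  Every generator inverts itself at every point at which it is defined, with its denominator being
  nonzero at the image again. Birationality is immediate from this. It also makes each generator
  dominant: the preimage of a nonempty Zariski open set contains a nonempty Zariski open set.
  Dominance is inherited by compositions, so every word in the generators is defined generically,
  whatever its denominators are. What remains of a relation is its verification at points where everything in sight is defined.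

  For generators \<open>f\<close> and \<open>g\<close>, the relation \<open>(f g)\<^sup>2\<^sup>m = 1\<close> follows from the
  braid form \<open>(f g)\<^sup>m = (g f)\<^sup>m\<close>, because \<open>(g f)\<^sup>m\<close> is inverse to
  \<open>(f g)\<^sup>m\<close> (\<open>order_from_braid\<close>). The braid relations of length four for \<open>s0, s1\<close>
  and for \<open>s1, s2\<close> are two instances of one rational identity
  (\<open>braid_identity\<close>), in which \<open>\<eta> s\<close> plays the role that \<open>-1\<close> plays for
  \<open>s2\<close>. The relations with \<open>\<pi>\<close> hold exactly, including domains of definition.
\<close>


section \<open>Polynomial functions and generic points\<close>

lemma poly_fun_uminus: "poly_fun f \<Longrightarrow> poly_fun (\<lambda>v. - f v)"
  using poly_fun.mult[OF poly_fun.const[of "-1"], of f] by simp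

lemma poly_fun_power: "poly_fun f \<Longrightarrow> poly_fun (\<lambda>v. f v ^ n)"
  by (induction n) (auto intro: poly_fun.intros)

text \<open>Closure rules in tuple form. With \<open>\<lambda>v. f v + g v\<close> in the conclusion, an
  abstraction over a tuple pattern does not unify; these forms let a polynomial expression in the
  coordinates be decomposed syntactically.\<close>

lemma poly_fun_add':
  assumes "poly_fun (\<lambda>(q1, p1, q2, p2, s). f q1 p1 q2 p2 s)"
    and "poly_fun (\<lambda>(q1, p1, q2, p2, s). g q1 p1 q2 p2 s)"
  shows "poly_fun (\<lambda>(q1, p1, q2, p2, s). f q1 p1 q2 p2 s + g q1 p1 q2 p2 s)"
  using poly_fun.add[OF assms] by (rule back_subst[of poly_fun]) auto

lemma poly_fun_mult':
  assumes "poly_fun (\<lambda>(q1, p1, q2, p2, s). f q1 p1 q2 p2 s)"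
    and "poly_fun (\<lambda>(q1, p1, q2, p2, s). g q1 p1 q2 p2 s)"
  shows "poly_fun (\<lambda>(q1, p1, q2, p2, s). f q1 p1 q2 p2 s * g q1 p1 q2 p2 s)"
  using poly_fun.mult[OF assms] by (rule back_subst[of poly_fun]) auto

lemma poly_fun_uminus':
  assumes "poly_fun (\<lambda>(q1, p1, q2, p2, s). f q1 p1 q2 p2 s)"
  shows "poly_fun (\<lambda>(q1, p1, q2, p2, s). - f q1 p1 q2 p2 s)"
  using poly_fun_uminus[OF assms] by (rule back_subst[of poly_fun]) auto

lemma poly_fun_diff':
  assumes "poly_fun (\<lambda>(q1, p1, q2, p2, s). f q1 p1 q2 p2 s)"
    and "poly_fun (\<lambda>(q1, p1, q2, p2, s). g q1 p1 q2 p2 s)"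
  shows "poly_fun (\<lambda>(q1, p1, q2, p2, s). f q1 p1 q2 p2 s - g q1 p1 q2 p2 s)"
  using poly_fun_add'[OF assms(1) poly_fun_uminus'[OF assms(2)]] by simp

lemma poly_fun_power':
  assumes "poly_fun (\<lambda>(q1, p1, q2, p2, s). f q1 p1 q2 p2 s)"
  shows "poly_fun (\<lambda>(q1, p1, q2, p2, s). f q1 p1 q2 p2 s ^ n)"
  using poly_fun_power[OF assms, of n] by (rule back_subst[of poly_fun]) auto

lemma poly_fun_const': "poly_fun (\<lambda>(q1, p1, q2, p2, s). c)"
  using poly_fun.const[of c] by (rule back_subst[of poly_fun]) auto

lemmas poly_fun_intros = poly_fun_const' poly_fun.q1 poly_fun.p1 poly_fun.q2 poly_fun.p2
  poly_fun.s poly_fun_add' poly_fun_diff' poly_fun_mult' poly_fun_uminus' poly_fun_power'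

text \<open>Restriction to a line turns a polynomial function into a polynomial in one variable, which has
  only finitely many zeros unless it vanishes. In this way properties of one-variable polynomials
  pass to polynomial functions on the phase space.\<close>

lemma poly_fun_on_line:
  assumes "poly_fun f"
  shows "\<exists>p. \<forall>t. f (a1 + t * b1, a2 + t * b2, a3 + t * b3, a4 + t * b4, a5 + t * b5) = poly p t"
  using assms
proof induction
  case (const c) show ?case by (rule exI[of _ "[:c:]"]) simp
next
  case q1 show ?case by (rule exI[of _ "[:a1, b1:]"]) simp
next
  case p1 show ?case by (rule exI[of _ "[:a2, b2:]"]) simp
next
  case q2 show ?case by (rule exI[of _ "[:a3, b3:]"]) simp
next
  case p2 show ?case by (rule exI[of _ "[:a4, b4:]"]) simp
next
  case s show ?case by (rule exI[of _ "[:a5, b5:]"]) simp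
next
  case (add f g) then show ?case by (metis poly_add)
next
  case (mult f g) then show ?case by (metis poly_mult)
qed

text \<open>Two nonempty Zariski open sets meet: on the line through a point of each, both polynomials
  are nonzero, hence so is their product.\<close>

lemma poly_fun_mult_nonzero:
  assumes "poly_fun f" "poly_fun g" "f v \<noteq> 0" "g w \<noteq> 0"
  shows "\<exists>u. f u * g u \<noteq> 0"
proof -
  obtain a1 a2 a3 a4 a5 where v: "v = (a1, a2, a3, a4, a5)" by (cases v)
  obtain c1 c2 c3 c4 c5 where w: "w = (c1, c2, c3, c4, c5)" by (cases w)
  define line where "line t = (a1 + t * (c1 - a1), a2 + t * (c2 - a2), a3 + t * (c3 - a3),
    a4 + t * (c4 - a4), a5 + t * (c5 - a5))" for t
  obtain p where p: "\<And>t. f (line t) = poly p t"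
    unfolding line_def using poly_fun_on_line[OF assms(1)] by metis
  obtain q where q: "\<And>t. g (line t) = poly q t"
    unfolding line_def using poly_fun_on_line[OF assms(2)] by metis
  have "poly p 0 \<noteq> 0" "poly q 1 \<noteq> 0"
    using assms(3,4) by (auto simp: p[symmetric] q[symmetric] line_def v w)
  then have "p * q \<noteq> 0" by auto
  then obtain t where "poly (p * q) t \<noteq> 0" using poly_all_0_iff_0 by blast
  then show ?thesis by (metis p q poly_mult)
qed

lemma generically_mono: "generically P \<Longrightarrow> (\<And>v. P v \<Longrightarrow> Q v) \<Longrightarrow> generically Q"
  unfolding generically_def by blast

lemma generically_conj:
  assumes "generically P" "generically Q"
  shows "generically (\<lambda>v. P v \<and> Q v)"
proof -
  obtain d v e w where "poly_fun d" "d v \<noteq> 0" "\<forall>v. d v \<noteq> 0 \<longrightarrow> P v"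
    "poly_fun e" "e w \<noteq> 0" "\<forall>v. e v \<noteq> 0 \<longrightarrow> Q v"
    using assms unfolding generically_def by blast
  then show ?thesis
    unfolding generically_def using poly_fun_mult_nonzero[of d e v w]
    by (intro exI[of _ "\<lambda>v. d v * e v"]) (auto intro: poly_fun.mult)
qed

lemma generically_ex: "generically P \<Longrightarrow> \<exists>v. P v"
  unfolding generically_def by blast


section \<open>Rational maps defined exactly off a hypersurface\<close>

text \<open>In contrast to \<^const>\<open>rational_map\<close>, the domain is exactly the complement of the zeros of
  \<open>d\<close>. Knowing the domain exactly is what allows clearing denominators at every point of it.\<close>

definition regular_off :: "(vars \<Rightarrow> complex) \<Rightarrow> (vars \<rightharpoonup> vars) \<Rightarrow> bool" where
  "regular_off d F \<longleftrightarrow> poly_fun d \<and> (\<exists>v. d v \<noteq> 0) \<and>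
     (\<exists>f1 f2 f3 f4 f5. poly_fun f1 \<and> poly_fun f2 \<and> poly_fun f3 \<and> poly_fun f4 \<and> poly_fun f5 \<and>
        (\<forall>v. F v = (if d v = 0 then None
                    else Some (f1 v / d v, f2 v / d v, f3 v / d v, f4 v / d v, f5 v / d v))))"

lemma regular_off_rational: "regular_off d F \<Longrightarrow> rational_map F"
  unfolding regular_off_def rational_map_def by metis

lemma regular_off_defined: "regular_off d F \<Longrightarrow> F v \<noteq> None \<longleftrightarrow> d v \<noteq> 0"
  unfolding regular_off_def by (elim conjE exE, erule allE[of _ v]) simp

lemma regular_off_generically: "regular_off d F \<Longrightarrow> generically (\<lambda>v. \<exists>w. F v = Some w)"
  using regular_off_defined[of d F] unfolding generically_def regular_off_def by blast

text \<open>Clearing denominators in \<open>g \<circ> F\<close>. Only a power of \<open>d\<close> is needed, and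
  \<open>d\<close> vanishes nowhere on the domain; hence \<open>h\<close> has the same zeros there as
  \<open>g \<circ> F\<close>.\<close>

lemma poly_fun_pullback:
  assumes "poly_fun g" and "regular_off d F"
  shows "\<exists>h n. poly_fun h \<and> (\<forall>v w. F v = Some w \<longrightarrow> h v = d v ^ n * g w)"
proof -
  have d: "poly_fun d" using assms(2) by (simp add: regular_off_def)
  obtain f1 f2 f3 f4 f5 where f: "poly_fun f1" "poly_fun f2" "poly_fun f3" "poly_fun f4" "poly_fun f5"
    and F: "\<And>v. F v = (if d v = 0 then None
                    else Some (f1 v / d v, f2 v / d v, f3 v / d v, f4 v / d v, f5 v / d v))"
    using assms(2) unfolding regular_off_def by blast
  have coordinate: "\<exists>h n. poly_fun h \<and> (\<forall>v w. F v = Some w \<longrightarrow> h v = d v ^ n * g w)"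
    if "poly_fun f" "\<And>v w. F v = Some w \<Longrightarrow> g w = f v / d v" for f g
  proof (intro exI conjI allI impI)
    show "f v = d v ^ 1 * g w" if "F v = Some w" for v w
      using that \<open>F v = Some w \<Longrightarrow> g w = f v / d v\<close> by (simp add: F split: if_splits)
  qed (rule that)
  show ?thesis using assms(1)
  proof induction
    case (const c)
    show ?case by (rule exI[of _ "\<lambda>_. c"], rule exI[of _ 0]) (auto intro: poly_fun.const)
  next
    case q1 show ?case by (rule coordinate[OF f(1)]) (auto simp: F split: if_splits)
  next
    case p1 show ?case by (rule coordinate[OF f(2)]) (auto simp: F split: if_splits)
  next
    case q2 show ?case by (rule coordinate[OF f(3)]) (auto simp: F split: if_splits)
  next
    case p2 show ?case by (rule coordinate[OF f(4)]) (auto simp: F split: if_splits)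
  next
    case s show ?case by (rule coordinate[OF f(5)]) (auto simp: F split: if_splits)
  next
    case (add f g)
    then obtain h m k n where hk: "poly_fun h" "\<And>v w. F v = Some w \<Longrightarrow> h v = d v ^ m * f w"
      "poly_fun k" "\<And>v w. F v = Some w \<Longrightarrow> k v = d v ^ n * g w" by blast
    show ?case
      by (rule exI[of _ "\<lambda>v. d v ^ n * h v + d v ^ m * k v"], rule exI[of _ "m + n"])
        (auto simp: hk(2,4) power_add distrib_left mult.assoc mult.left_commute
          intro!: poly_fun.add poly_fun.mult poly_fun_power hk(1,3) d)
  next
    case (mult f g)
    then obtain h m k n where hk: "poly_fun h" "\<And>v w. F v = Some w \<Longrightarrow> h v = d v ^ m * f w"
      "poly_fun k" "\<And>v w. F v = Some w \<Longrightarrow> k v = d v ^ n * g w" by blast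
    show ?case
      by (rule exI[of _ "\<lambda>v. h v * k v"], rule exI[of _ "m + n"])
        (auto simp: hk(2,4) power_add intro!: poly_fun.mult hk(1,3))
  qed
qed

text \<open>The pulled-back polynomial could vanish identically if the image of \<open>F\<close> lay in the exceptional set of
  \<open>Q\<close>. A generic image point excludes this: it is hit by some \<open>v\<close>, and there the
  pullback is nonzero.\<close>

lemma generically_pullback:
  assumes F: "regular_off d F" and dom: "generically (\<lambda>w. \<exists>v. F v = Some w)"
    and Q: "generically Q"
  shows "generically (\<lambda>v. \<exists>w. F v = Some w \<and> Q w)"
proof -
  obtain g where g: "poly_fun g" "\<exists>w. g w \<noteq> 0"
    "\<And>w. g w \<noteq> 0 \<Longrightarrow> (\<exists>v. F v = Some w) \<and> Q w"
    using generically_conj[OF dom Q] unfolding generically_def by blast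
  obtain h n where h: "poly_fun h" "\<And>v w. F v = Some w \<Longrightarrow> h v = d v ^ n * g w"
    using poly_fun_pullback[OF g(1) F] by blast
  obtain v w where vw: "F v = Some w" "g w \<noteq> 0" using g by blast
  have d: "poly_fun d" using F by (simp add: regular_off_def)
  \<comment> \<open>The factor \<open>d\<close> keeps the new open set inside the domain of \<open>F\<close>.\<close>
  have "d v * h v \<noteq> 0" using vw h(2)[OF vw(1)] regular_off_defined[OF F, of v] by simp
  moreover have "\<exists>w. F v = Some w \<and> Q w" if "d v * h v \<noteq> 0" for v
  proof -
    have "F v \<noteq> None" using that regular_off_defined[OF F, of v] by simp
    then obtain w where w: "F v = Some w" by blast
    then have "g w \<noteq> 0" using that h(2)[OF w] by auto
    then show ?thesis using g(3) w by blast
  qed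
  ultimately show ?thesis
    unfolding generically_def using poly_fun.mult[OF d h(1)] by blast
qed

lemma birational_inverse_pair:
  assumes "regular_off d F" "regular_off e G"
    and "\<And>v w. F v = Some w \<longleftrightarrow> G w = Some v"
  shows "birational F"
proof -
  have "generically (\<lambda>v. (G \<circ>\<^sub>m F) v = Some v)"
  proof (rule generically_mono[OF regular_off_generically[OF assms(1)]], elim exE)
    fix v w assume "F v = Some w"
    then show "(G \<circ>\<^sub>m F) v = Some v" using assms(3)[of v w] by (simp add: map_comp_def)
  qed
  moreover have "generically (\<lambda>v. (F \<circ>\<^sub>m G) v = Some v)"
  proof (rule generically_mono[OF regular_off_generically[OF assms(2)]], elim exE)
    fix v w assume "G v = Some w"
    then show "(F \<circ>\<^sub>m G) v = Some v" using assms(3)[of w v] by (simp add: map_comp_def)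
  qed
  ultimately show ?thesis
    unfolding birational_def
    using regular_off_rational[OF assms(1)] regular_off_rational[OF assms(2)] by (intro conjI exI[of _ G])
qed


section \<open>Dominant transformations\<close>

text \<open>The property \<open>Q\<close> may depend on the parameters as well, since \<open>T\<close> moves both. Quantifying
  over all parameters in \<open>A\<close> on both sides makes the notion compositional.\<close>

definition dominant :: "params set \<Rightarrow> transformation \<Rightarrow> bool" where
  "dominant A T \<longleftrightarrow> (\<forall>Q. (\<forall>a\<in>A. generically (\<lambda>v. Q (v, a))) \<longrightarrow>
     (\<forall>a\<in>A. generically (\<lambda>v. \<exists>x. T (v, a) = Some x \<and> Q x)))"

lemma dominant_comp:
  assumes "dominant A S" "dominant A T" shows "dominant A (S \<circ>\<^sub>m T)"
  unfolding dominant_def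
proof (intro allI impI)
  fix Q :: "vars \<times> params \<Rightarrow> bool"
  assume "\<forall>a\<in>A. generically (\<lambda>v. Q (v, a))"
  then have "\<forall>a\<in>A. generically (\<lambda>v. \<exists>y. S (v, a) = Some y \<and> Q y)"
    using assms(1) unfolding dominant_def by blast
  then have "\<forall>a\<in>A. generically (\<lambda>v. \<exists>x. T (v, a) = Some x \<and> (\<exists>y. S x = Some y \<and> Q y))"
    using assms(2) unfolding dominant_def by fast
  then show "\<forall>a\<in>A. generically (\<lambda>v. \<exists>x. (S \<circ>\<^sub>m T) (v, a) = Some x \<and> Q x)"
    by (auto simp: map_comp_def elim!: generically_mono)
qed

lemma dominant_power: "dominant A T \<Longrightarrow> dominant A (power_map T n)"
  by (induction n) (auto simp: dominant_def[of A Some] intro: dominant_comp)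

lemma dominant_defined:
  assumes "dominant A T" "a \<in> A" shows "generically (\<lambda>v. \<exists>x. T (v, a) = Some x)"
proof -
  have "generically (\<lambda>v. True)"
    unfolding generically_def by (rule exI[of _ "\<lambda>_. 1"]) (auto intro: poly_fun.const)
  then show ?thesis
    using assms(1)[unfolded dominant_def, THEN spec, of "\<lambda>_. True"] assms(2) by simp
qed

text \<open>Definedness of a dominant map is automatic, so an equality of rational maps may be checked
  pointwise.\<close>

lemma rat_eq_if_dominant:
  assumes "dominant A S" "\<And>x y. S x = Some y \<Longrightarrow> T x = Some y"
  shows "rat_eq A S T"
  unfolding rat_eq_def
proof
  fix a assume "a \<in> A"
  from dominant_defined[OF assms(1) this]
  show "generically (\<lambda>v. S (v, a) \<noteq> None \<and> S (v, a) = T (v, a))"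
    by (rule generically_mono) (metis assms(2) option.distinct(1))
qed


section \<open>Birational involutions and orders of products\<close>

text \<open>In particular, \<open>f\<close> maps its domain into itself, so that involutive maps can be
  cancelled pointwise in words.\<close>

definition involutive :: "('a \<rightharpoonup> 'a) \<Rightarrow> bool" where
  "involutive f \<longleftrightarrow> (\<forall>x y. f x = Some y \<longrightarrow> f y = Some x)"

lemma involutiveI: "(\<And>x y. f x = Some y \<Longrightarrow> f y = Some x) \<Longrightarrow> involutive f"
  unfolding involutive_def by blast

definition birational_involution :: "params set \<Rightarrow> (params \<Rightarrow> params) \<Rightarrow> transformation \<Rightarrow> bool" where
  "birational_involution A \<tau> T \<longleftrightarrow> involutive T \<and>
     (\<forall>v a w b. T (v, a) = Some (w, b) \<longrightarrow> b = \<tau> a) \<and>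
     (\<forall>a\<in>A. \<tau> a \<in> A \<and> (\<exists>d. regular_off d (at_params T a)))"

text \<open>Reading the involution at fixed parameters: the inverse of \<open>T\<close> at \<open>a\<close> is \<open>T\<close> at
  the transformed parameters. For the converse direction one needs \<open>\<tau> (\<tau> a) = a\<close>, which follows from the involution property
  at any single point where \<open>T\<close> is defined.\<close>

lemma birational_involution_inverse:
  assumes "birational_involution A \<tau> T" "a \<in> A"
  shows "at_params T a v = Some w \<longleftrightarrow> at_params T (\<tau> a) w = Some v"
proof -
  have inv: "\<And>x y. T x = Some y \<Longrightarrow> T y = Some x"
    and \<tau>: "\<And>v a w b. T (v, a) = Some (w, b) \<Longrightarrow> b = \<tau> a"
    using assms(1) unfolding birational_involution_def involutive_def by blast+
  have iff: "at_params T c v = Some w \<longleftrightarrow> T (v, c) = Some (w, \<tau> c)" for c v w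
  proof (cases "T (v, c)")
    case (Some x)
    then show ?thesis using \<tau>[of v c "fst x" "snd x"] by (cases x) (simp add: at_params_def)
  qed (simp add: at_params_def)
  obtain d where "regular_off d (at_params T a)"
    using assms unfolding birational_involution_def by blast
  from generically_ex[OF regular_off_generically[OF this]]
  obtain v' w' where "at_params T a v' = Some w'" by blast
  then have "T (w', \<tau> a) = Some (v', a)" by (intro inv[of "(v', a)"]) (simp add: iff)
  then have "\<tau> (\<tau> a) = a" by (rule \<tau>[symmetric])
  then show ?thesis using inv[of "(v, a)" "(w, \<tau> a)"] inv[of "(w, \<tau> a)" "(v, a)"] by (auto simp: iff)
qed

lemma birational_involution_birational:
  assumes "birational_involution A \<tau> T" "a \<in> A"
  shows "birational (at_params T a)"
proof -
  obtain d e where "regular_off d (at_params T a)" "regular_off e (at_params T (\<tau> a))"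
    using assms unfolding birational_involution_def by blast
  then show ?thesis
    by (rule birational_inverse_pair) (rule birational_involution_inverse[OF assms])
qed

text \<open>Since the inverse is also defined generically, generic points are images, as
  \<open>generically_pullback\<close> requires.\<close>

lemma birational_involution_dominant:
  assumes T: "birational_involution A \<tau> T"
  shows "dominant A T"
  unfolding dominant_def
proof (intro allI impI ballI)
  fix Q a assume Q: "\<forall>a\<in>A. generically (\<lambda>v. Q (v, a))" and a: "a \<in> A"
  have \<tau>: "\<tau> a \<in> A" "\<And>v w b. T (v, a) = Some (w, b) \<Longrightarrow> b = \<tau> a"
    using T a unfolding birational_involution_def by blast+
  obtain d e where reg: "regular_off d (at_params T a)" "regular_off e (at_params T (\<tau> a))"
    using T a \<tau>(1) unfolding birational_involution_def by blast
  have "generically (\<lambda>w. \<exists>v. at_params T a v = Some w)"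
    using regular_off_generically[OF reg(2)] birational_involution_inverse[OF T a] by simp
  from generically_pullback[OF reg(1) this bspec[OF Q \<tau>(1)]]
  have "generically (\<lambda>v. \<exists>w. at_params T a v = Some w \<and> Q (w, \<tau> a))" .
  then show "generically (\<lambda>v. \<exists>x. T (v, a) = Some x \<and> Q x)"
  proof (rule generically_mono, elim exE conjE)
    fix v w assume w: "at_params T a v = Some w" "Q (w, \<tau> a)"
    then obtain b where b: "T (v, a) = Some (w, b)" by (auto simp: at_params_def)
    then show "\<exists>x. T (v, a) = Some x \<and> Q x" using w(2) \<tau>(2)[OF b] by blast
  qed
qed

lemma power_map_add: "power_map f (m + n) x = (power_map f m \<circ>\<^sub>m power_map f n) x"
  by (induction m) (auto simp: map_comp_def split: option.split)

lemma power_map_Suc_right: "power_map f (Suc n) = power_map f n \<circ>\<^sub>m f"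
  by (induction n) (auto simp: map_comp_def fun_eq_iff split: option.split)

text \<open>The inverse of the word \<open>g f g f \<dots>\<close> is the same word read backwards.\<close>

lemma power_map_reverse:
  assumes "involutive f" "involutive g" "power_map (g \<circ>\<^sub>m f) n x = Some y"
  shows "power_map (f \<circ>\<^sub>m g) n y = Some x"
  using assms(3)
proof (induction n arbitrary: y)
  case (Suc n)
  then obtain z w where "power_map (g \<circ>\<^sub>m f) n x = Some z" "f z = Some w" "g w = Some y"
    by (auto simp: map_comp_def split: option.splits)
  then have "power_map (f \<circ>\<^sub>m g) n z = Some x" "f w = Some z" "g y = Some w"
    using Suc.IH assms(1,2) unfolding involutive_def by blast+
  then show ?case by (simp add: power_map_Suc_right map_comp_def del: power_map.simps)
qed simp

text \<open>Let \<open>y = (f g)\<^sup>m x = (g f)\<^sup>m x\<close>. Undoing \<open>(g f)\<^sup>m\<close> means applying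
  \<open>(f g)\<^sup>m\<close>, so \<open>(f g)\<^sup>m y = x\<close>. Both words are defined at generic
  \<open>x\<close> by dominance, and then \<open>(f g)\<^sup>m\<close> is defined at \<open>y\<close> because the
  generators are involutive.\<close>

lemma order_from_braid:
  assumes "involutive f" "involutive g" "dominant A f" "dominant A g"
    and braid: "\<And>x y z. power_map (f \<circ>\<^sub>m g) m x = Some y \<Longrightarrow>
      power_map (g \<circ>\<^sub>m f) m x = Some z \<Longrightarrow> y = z"
  shows "rat_eq A (power_map (f \<circ>\<^sub>m g) (m + m)) Some"
  unfolding rat_eq_def
proof
  fix a assume a: "a \<in> A"
  have "generically (\<lambda>v. (\<exists>y. power_map (f \<circ>\<^sub>m g) m (v, a) = Some y) \<and> (\<exists>z. power_map (g \<circ>\<^sub>m f) m (v, a) = Some z))"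
    by (intro generically_conj dominant_defined[OF _ a] dominant_power dominant_comp assms)
  then show "generically (\<lambda>v. power_map (f \<circ>\<^sub>m g) (m + m) (v, a) \<noteq> None \<and>
      power_map (f \<circ>\<^sub>m g) (m + m) (v, a) = Some (v, a))"
  proof (rule generically_mono, elim conjE exE)
    fix v y z
    assume y: "power_map (f \<circ>\<^sub>m g) m (v, a) = Some y" and z: "power_map (g \<circ>\<^sub>m f) m (v, a) = Some z"
    have "power_map (f \<circ>\<^sub>m g) m y = Some (v, a)"
      using power_map_reverse[OF assms(1,2) z] braid[OF y z] by simp
    then show "power_map (f \<circ>\<^sub>m g) (m + m) (v, a) \<noteq> None \<and>
        power_map (f \<circ>\<^sub>m g) (m + m) (v, a) = Some (v, a)"
      using y by (simp add: power_map_add map_comp_def)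
  qed
qed

lemma rat_eq_involutive:
  assumes "involutive T" "dominant A T" shows "rat_eq A (power_map T 2) Some"
proof (intro rat_eq_if_dominant dominant_power assms(2))
  show "Some x = Some y" if "power_map T 2 x = Some y" for x y
  proof -
    obtain z where "T x = Some z" "T z = Some y"
      using \<open>power_map T 2 x = Some y\<close> by (auto simp: numeral_2_eq_2 map_comp_def split: option.splits)
    moreover from this have "T z = Some x" using assms(1) unfolding involutive_def by blast
    ultimately show ?thesis by simp
  qed
qed


section \<open>Transport of solutions\<close>

text \<open>The curve, as a function of \<open>s\<close>, satisfies at \<open>s\<close> the differential equations in the
  independent variable \<open>t = \<epsilon> s\<close>: these are multiplied by \<open>dt/ds = \<epsilon>\<close>.
  For \<open>\<epsilon> = 1\<close> this is the system itself, and \<open>\<epsilon> = -1\<close> is what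
  \<open>s0\<close> and \<open>s2\<close> produce.\<close>

definition solves_at :: "complex \<Rightarrow> params \<Rightarrow> curve \<Rightarrow> complex \<Rightarrow> bool" where
  "solves_at \<epsilon> = (\<lambda>(\<eta>, \<alpha>0, \<alpha>1, \<alpha>2) (q1, p1, q2, p2) s.
     (q1 has_field_derivative
        (- ((q1 s)\<^sup>2 * p1 s / (\<epsilon> * s)) + \<alpha>2 * q1 s / (\<epsilon> * s) - p2 s / (\<epsilon> * s)) * \<epsilon>) (at s) \<and>
     (p1 has_field_derivative
        (q1 s * (p1 s)\<^sup>2 / (\<epsilon> * s) - \<alpha>2 * p1 s / (\<epsilon> * s) - 1 / (2 * (\<epsilon> * s))) * \<epsilon>) (at s) \<and>
     (q2 has_field_derivative
        (- ((q2 s)\<^sup>2 * p2 s / (\<epsilon> * s)) - (\<alpha>1 + \<alpha>2) * q2 s / (\<epsilon> * s) - p1 s / (\<epsilon> * s)) * \<epsilon>) (at s) \<and>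
     (p2 has_field_derivative
        (q2 s * (p2 s)\<^sup>2 / (\<epsilon> * s) + (\<alpha>1 + \<alpha>2) * p2 s / (\<epsilon> * s) + \<eta> / 2) * \<epsilon>) (at s))"

lemma solution_iff:
  "solution a U y \<longleftrightarrow> open U \<and> 0 \<notin> U \<and> (\<forall>s\<in>U. solves_at 1 a y s)"
  by (cases a; cases y) (simp add: solution_def solves_at_def)

lemma solves_at_derivatives:
  assumes "solves_at 1 (\<eta>, \<alpha>0, \<alpha>1, \<alpha>2) (q1, p1, q2, p2) s"
  shows "(q1 has_field_derivative
        - ((q1 s)\<^sup>2 * p1 s / s) + \<alpha>2 * q1 s / s - p2 s / s) (at s)"
    and "(p1 has_field_derivative
        q1 s * (p1 s)\<^sup>2 / s - \<alpha>2 * p1 s / s - 1 / (2 * s)) (at s)"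
    and "(q2 has_field_derivative
        - ((q2 s)\<^sup>2 * p2 s / s) - (\<alpha>1 + \<alpha>2) * q2 s / s - p1 s / s) (at s)"
    and "(p2 has_field_derivative
        q2 s * (p2 s)\<^sup>2 / s + (\<alpha>1 + \<alpha>2) * p2 s / s + \<eta> / 2) (at s)"
  using assms unfolding solves_at_def split mult_1 mult_1_right by blast+

text \<open>This reduces the transport of whole solutions to a computation at a single point. The transformed curve is
  reparametrized by \<open>t \<mapsto> \<epsilon> t\<close>, its own inverse, so that it is a function of the new
  independent variable on the open set \<open>\<epsilon> U\<close>.\<close>

lemma carriesI:
  fixes \<epsilon> :: complex
  assumes \<epsilon>: "\<epsilon> * \<epsilon> = 1"
    and F: "\<And>q1 p1 q2 p2 s w. F (q1, p1, q2, p2, s) = Some w \<Longrightarrow>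
      w = (f1 q1 p1 q2 p2 s, f2 q1 p1 q2 p2 s, f3 q1 p1 q2 p2 s, f4 q1 p1 q2 p2 s, \<epsilon> * s)"
    and D: "\<And>q1 p1 q2 p2 s. s \<noteq> 0 \<Longrightarrow> F (q1 s, p1 s, q2 s, p2 s, s) \<noteq> None \<Longrightarrow>
      solves_at 1 a (q1, p1, q2, p2) s \<Longrightarrow>
      solves_at \<epsilon> b
        (\<lambda>s. f1 (q1 s) (p1 s) (q2 s) (p2 s) s, \<lambda>s. f2 (q1 s) (p1 s) (q2 s) (p2 s) s,
         \<lambda>s. f3 (q1 s) (p1 s) (q2 s) (p2 s) s, \<lambda>s. f4 (q1 s) (p1 s) (q2 s) (p2 s) s) s"
  shows "carries a b F"
  unfolding carries_def
proof (intro allI impI, elim conjE)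
  fix U :: "complex set" and y :: curve
  assume sol: "solution a U y" and dom: "graph U y \<subseteq> dom F"
  obtain q1 p1 q2 p2 where y: "y = (q1, p1, q2, p2)" by (cases y)
  have U: "open U" "0 \<notin> U" using sol by (auto simp: solution_iff)
  have \<epsilon>0: "\<epsilon> \<noteq> 0" using \<epsilon> by auto
  have \<epsilon>2: "\<epsilon> * (\<epsilon> * s) = s" for s by (simp add: mult.assoc[symmetric] \<epsilon>)
  have V: "(\<lambda>s. \<epsilon> * s) ` U = (\<lambda>s. \<epsilon> * s) -` U"
  proof (intro set_eqI iffI)
    fix t assume "t \<in> (\<lambda>s. \<epsilon> * s) -` U"
    then show "t \<in> (\<lambda>s. \<epsilon> * s) ` U" by (intro image_eqI[of _ _ "\<epsilon> * t"]) (simp_all add: \<epsilon>2)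
  qed (auto simp: \<epsilon>2)
  have openV: "open ((\<lambda>s. \<epsilon> * s) ` U)"
    unfolding V by (rule continuous_open_vimage[OF U(1)]) (auto intro!: continuous_intros)
  have chain: "((\<lambda>t. f (\<epsilon> * t)) has_field_derivative d) (at (\<epsilon> * s))"
    if "(f has_field_derivative d * \<epsilon>) (at s)" for f d s
  proof -
    have f: "(f has_field_derivative d * \<epsilon>) (at (\<epsilon> * (\<epsilon> * s)))" using that by (simp add: \<epsilon>2)
    have g: "((\<lambda>t. \<epsilon> * t) has_field_derivative \<epsilon>) (at (\<epsilon> * s))"
      by (auto intro!: derivative_eq_intros)
    from DERIV_chain2[OF f g] show ?thesis by (simp add: mult.assoc \<epsilon>)
  qed
  define z where "z = (\<lambda>g. (\<lambda>t. g (q1 (\<epsilon> * t)) (p1 (\<epsilon> * t)) (q2 (\<epsilon> * t)) (p2 (\<epsilon> * t)) (\<epsilon> * t) :: complex))"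
  have "solution b ((\<lambda>s. \<epsilon> * s) ` U) (z f1, z f2, z f3, z f4)"
    unfolding solution_iff
  proof (intro conjI openV)
    show "0 \<notin> (\<lambda>s. \<epsilon> * s) ` U" using U \<epsilon>0 by auto
    show "\<forall>s\<in>(\<lambda>s. \<epsilon> * s) ` U. solves_at 1 b (z f1, z f2, z f3, z f4) s"
    proof (intro ballI, elim imageE)
      fix t s assume t: "t = \<epsilon> * s" and s: "s \<in> U"
      have d: "F (q1 s, p1 s, q2 s, p2 s, s) \<noteq> None" using dom s by (auto simp: graph_def y)
      have s0: "s \<noteq> 0" using s U by auto
      have "solves_at 1 a (q1, p1, q2, p2) s" using sol s by (simp add: solution_iff y)
      note new = D[of s q1 p1 q2 p2, OF s0 d this]
      have z: "z g (\<epsilon> * s) = g (q1 s) (p1 s) (q2 s) (p2 s) s" for g by (simp add: z_def \<epsilon>2)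
      obtain \<eta> \<alpha>0 \<alpha>1 \<alpha>2 where b: "b = (\<eta>, \<alpha>0, \<alpha>1, \<alpha>2)" by (cases b)
      show "solves_at 1 b (z f1, z f2, z f3, z f4) t"
        using new unfolding solves_at_def b t split z mult_1 mult_1_right
        unfolding z_def by (intro conjI chain; blast)
    qed
  qed
  moreover have "graph ((\<lambda>s. \<epsilon> * s) ` U) (z f1, z f2, z f3, z f4) = (\<lambda>v. the (F v)) ` graph U y"
  proof -
    have "the (F (q1 s, p1 s, q2 s, p2 s, s)) = (z f1 (\<epsilon> * s), z f2 (\<epsilon> * s), z f3 (\<epsilon> * s), z f4 (\<epsilon> * s), \<epsilon> * s)"
      if "s \<in> U" for s
    proof -
      have "F (q1 s, p1 s, q2 s, p2 s, s) \<noteq> None" using dom that by (auto simp: graph_def y)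
      then show ?thesis using F by (fastforce simp: z_def \<epsilon>2)
    qed
    then show ?thesis by (simp add: graph_def y image_image)
  qed
  ultimately show "\<exists>V z. solution b V z \<and> graph V z = (\<lambda>v. the (F v)) ` graph U y"
    by blast
qed


section \<open>The generators are birational involutions\<close>

lemma BacklundI:
  assumes "birational_involution A \<tau> T" "\<And>a. a \<in> A \<Longrightarrow> carries a (\<tau> a) (at_params T a)"
  shows "Backlund A T"
proof -
  have "\<tau> a \<in> A \<and> (\<forall>v w b. T (v, a) = Some (w, b) \<longrightarrow> b = \<tau> a) \<and>
    birational (at_params T a) \<and> carries a (\<tau> a) (at_params T a)" if "a \<in> A" for a
    using assms(2)[OF that] birational_involution_birational[OF assms(1) that] assms(1) that
    unfolding birational_involution_def by blast
  then show ?thesis unfolding Backlund_def by (intro exI[of _ \<tau>] ballI)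
qed

lemma regular_offI:
  assumes "poly_fun (\<lambda>(q1, p1, q2, p2, s). d q1 p1 q2 p2 s)"
    "poly_fun (\<lambda>(q1, p1, q2, p2, s). f1 q1 p1 q2 p2 s)"
    "poly_fun (\<lambda>(q1, p1, q2, p2, s). f2 q1 p1 q2 p2 s)"
    "poly_fun (\<lambda>(q1, p1, q2, p2, s). f3 q1 p1 q2 p2 s)"
    "poly_fun (\<lambda>(q1, p1, q2, p2, s). f4 q1 p1 q2 p2 s)"
    "poly_fun (\<lambda>(q1, p1, q2, p2, s). f5 q1 p1 q2 p2 s)"
    and nz: "d c1 c2 c3 c4 c5 \<noteq> 0"
    and F: "\<And>q1 p1 q2 p2 s. F (q1, p1, q2, p2, s) = (if d q1 p1 q2 p2 s = 0 then None else
      Some (f1 q1 p1 q2 p2 s / d q1 p1 q2 p2 s, f2 q1 p1 q2 p2 s / d q1 p1 q2 p2 s,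
        f3 q1 p1 q2 p2 s / d q1 p1 q2 p2 s, f4 q1 p1 q2 p2 s / d q1 p1 q2 p2 s,
        f5 q1 p1 q2 p2 s / d q1 p1 q2 p2 s))"
  shows "regular_off (\<lambda>(q1, p1, q2, p2, s). d q1 p1 q2 p2 s) F"
proof -
  let ?at = "\<lambda>f (q1 :: complex, p1 :: complex, q2 :: complex, p2 :: complex, s :: complex).
    f q1 p1 q2 p2 s :: complex"
  have "\<exists>v. ?at d v \<noteq> 0"
    using nz by (intro exI[of _ "(c1, c2, c3, c4, c5)"]) simp
  moreover have F': "F v = (if ?at d v = 0 then None else Some (?at f1 v / ?at d v, ?at f2 v / ?at d v,
      ?at f3 v / ?at d v, ?at f4 v / ?at d v, ?at f5 v / ?at d v))" for v
    by (cases v) (simp only: F split)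
  ultimately show ?thesis
    using assms(1) unfolding regular_off_def
    by (intro conjI exI[of _ "?at f1"] exI[of _ "?at f2"] exI[of _ "?at f3"] exI[of _ "?at f4"]
        exI[of _ "?at f5"] allI F' assms(2-6))
qed

definition s0_params :: "params \<Rightarrow> params" where
  "s0_params = (\<lambda>(\<eta>, \<alpha>0, \<alpha>1, \<alpha>2). (\<eta>, - \<alpha>0, \<alpha>1 + 2 * \<alpha>0, \<alpha>2))"
definition s1_params :: "params \<Rightarrow> params" where
  "s1_params = (\<lambda>(\<eta>, \<alpha>0, \<alpha>1, \<alpha>2). (\<eta>, \<alpha>0 + \<alpha>1, - \<alpha>1, \<alpha>2 + \<alpha>1))"
definition s2_params :: "params \<Rightarrow> params" where
  "s2_params = (\<lambda>(\<eta>, \<alpha>0, \<alpha>1, \<alpha>2). (\<eta>, \<alpha>0, \<alpha>1 + 2 * \<alpha>2, - \<alpha>2))"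
definition \<pi>_params :: "params \<Rightarrow> params" where
  "\<pi>_params = (\<lambda>(\<eta>, \<alpha>0, \<alpha>1, \<alpha>2). (\<eta>, \<alpha>2, \<alpha>1, \<alpha>0))"

lemma s0_involutive: "involutive s0"
proof (rule involutiveI)
  show "s0 y = Some x" if "s0 x = Some y" for x y
    using that by (cases x rule: s0.cases) (auto split: if_splits)
qed

lemma s1_involutive: "involutive s1"
proof (rule involutiveI)
  show "s1 y = Some x" if "s1 x = Some y" for x y
    using that by (cases x rule: s1.cases) (auto split: if_splits)
qed

lemma s2_involutive: "involutive s2"
proof (rule involutiveI)
  show "s2 y = Some x" if "s2 x = Some y" for x y
    using that by (cases x rule: s2.cases) (auto split: if_splits)
qed

lemma \<pi>_involutive: "involutive \<pi>"
proof (rule involutiveI)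
  show "\<pi> y = Some x" if "\<pi> x = Some y" for x y
    using that by (cases x rule: \<pi>.cases) (auto split: if_splits)
qed

text \<open>The parameter set is left general because \<open>s0\<close> and \<open>s1\<close> are needed both on all
  normalized parameters and on those with \<open>\<eta> \<noteq> 0\<close>, where they are composed with \<open>\<pi>\<close>. In
  each case all components are put over the common denominator \<open>d\<close>.\<close>

lemma s0_birational_involution:
  assumes "\<And>a. a \<in> A \<Longrightarrow> s0_params a \<in> A" shows "birational_involution A s0_params s0"
  unfolding birational_involution_def
proof (intro conjI ballI s0_involutive assms)
  show "\<forall>v a w b. s0 (v, a) = Some (w, b) \<longrightarrow> b = s0_params a"
    by (auto simp: s0_params_def split: if_splits)
  fix a :: params
  obtain \<eta> \<alpha>0 \<alpha>1 \<alpha>2 where a: "a = (\<eta>, \<alpha>0, \<alpha>1, \<alpha>2)" by (cases a)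
  show "\<exists>d. regular_off d (at_params s0 a)"
    by (rule exI, rule regular_offI[where d = "\<lambda>q1 p1 q2 p2 s. p2\<^sup>2"
          and ?f1.0 = "\<lambda>q1 p1 q2 p2 s. q1 * p2\<^sup>2" and ?f2.0 = "\<lambda>q1 p1 q2 p2 s. p1 * p2\<^sup>2"
          and ?f3.0 = "\<lambda>q1 p1 q2 p2 s. q2 * p2\<^sup>2 - 2 * \<alpha>0 * p2 + \<eta> * s"
          and ?f4.0 = "\<lambda>q1 p1 q2 p2 s. p2 * p2\<^sup>2" and ?f5.0 = "\<lambda>q1 p1 q2 p2 s. - s * p2\<^sup>2"
          and ?c4.0 = 1])
      (intro poly_fun_intros | simp add: a at_params_def field_simps power2_eq_square)+
qed

lemma s1_birational_involution:
  assumes "\<And>a. a \<in> A \<Longrightarrow> s1_params a \<in> A" shows "birational_involution A s1_params s1"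
  unfolding birational_involution_def
proof (intro conjI ballI s1_involutive assms)
  show "\<forall>v a w b. s1 (v, a) = Some (w, b) \<longrightarrow> b = s1_params a"
    by (auto simp: s1_params_def split: if_splits)
  fix a :: params
  obtain \<eta> \<alpha>0 \<alpha>1 \<alpha>2 where a: "a = (\<eta>, \<alpha>0, \<alpha>1, \<alpha>2)" by (cases a)
  show "\<exists>d. regular_off d (at_params s1 a)"
    by (rule exI, rule regular_offI[where d = "\<lambda>q1 p1 q2 p2 s. q1 * q2 + 1"
          and ?f1.0 = "\<lambda>q1 p1 q2 p2 s. q1 * (q1 * q2 + 1)"
          and ?f2.0 = "\<lambda>q1 p1 q2 p2 s. p1 * (q1 * q2 + 1) + \<alpha>1 * q2"
          and ?f3.0 = "\<lambda>q1 p1 q2 p2 s. q2 * (q1 * q2 + 1)"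
          and ?f4.0 = "\<lambda>q1 p1 q2 p2 s. p2 * (q1 * q2 + 1) + \<alpha>1 * q1"
          and ?f5.0 = "\<lambda>q1 p1 q2 p2 s. s * (q1 * q2 + 1)" and ?c1.0 = 0])
      (intro poly_fun_intros | simp add: a at_params_def add_divide_distrib)+
qed

lemma s2_birational_involution:
  assumes "\<And>a. a \<in> A \<Longrightarrow> s2_params a \<in> A" shows "birational_involution A s2_params s2"
  unfolding birational_involution_def
proof (intro conjI ballI s2_involutive assms)
  show "\<forall>v a w b. s2 (v, a) = Some (w, b) \<longrightarrow> b = s2_params a"
    by (auto simp: s2_params_def split: if_splits)
  fix a :: params
  obtain \<eta> \<alpha>0 \<alpha>1 \<alpha>2 where a: "a = (\<eta>, \<alpha>0, \<alpha>1, \<alpha>2)" by (cases a)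
  show "\<exists>d. regular_off d (at_params s2 a)"
    by (rule exI, rule regular_offI[where d = "\<lambda>q1 p1 q2 p2 s. p1\<^sup>2"
          and ?f1.0 = "\<lambda>q1 p1 q2 p2 s. - q1 * p1\<^sup>2 + 2 * \<alpha>2 * p1 + 1"
          and ?f2.0 = "\<lambda>q1 p1 q2 p2 s. - p1 * p1\<^sup>2" and ?f3.0 = "\<lambda>q1 p1 q2 p2 s. - q2 * p1\<^sup>2"
          and ?f4.0 = "\<lambda>q1 p1 q2 p2 s. - p2 * p1\<^sup>2" and ?f5.0 = "\<lambda>q1 p1 q2 p2 s. - s * p1\<^sup>2"
          and ?c2.0 = 1])
      (intro poly_fun_intros | simp add: a at_params_def field_simps power2_eq_square)+
qed

lemma \<pi>_birational_involution:
  assumes "\<And>a. a \<in> A \<Longrightarrow> \<pi>_params a \<in> A" and "A \<subseteq> nonzero_eta"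
  shows "birational_involution A \<pi>_params \<pi>"
  unfolding birational_involution_def
proof (intro conjI ballI \<pi>_involutive assms(1))
  show "\<forall>v a w b. \<pi> (v, a) = Some (w, b) \<longrightarrow> b = \<pi>_params a"
    by (auto simp: \<pi>_params_def split: if_splits)
  fix a assume "a \<in> A"
  then obtain \<eta> \<alpha>0 \<alpha>1 \<alpha>2 where a: "a = (\<eta>, \<alpha>0, \<alpha>1, \<alpha>2)" "\<eta> \<noteq> 0"
    using assms(2) by (cases a) (auto simp: nonzero_eta_def)
  show "\<exists>d. regular_off d (at_params \<pi> a)"
    by (rule exI, rule regular_offI[where d = "\<lambda>q1 p1 q2 p2 s. \<eta> * s"
          and ?f1.0 = "\<lambda>q1 p1 q2 p2 s. - (\<eta> * s * q2) * (\<eta> * s)"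
          and ?f2.0 = "\<lambda>q1 p1 q2 p2 s. - p2" and ?f3.0 = "\<lambda>q1 p1 q2 p2 s. - q1"
          and ?f4.0 = "\<lambda>q1 p1 q2 p2 s. - (\<eta> * s * p1) * (\<eta> * s)"
          and ?f5.0 = "\<lambda>q1 p1 q2 p2 s. s * (\<eta> * s)" and ?c5.0 = 1])
      (intro poly_fun_intros | simp add: a at_params_def)+
qed

section \<open>The generators carry solutions to solutions\<close>

text \<open>Normalization makes the coefficient \<open>\<alpha>1 + \<alpha>2\<close> equal to \<open>1 - \<alpha>0\<close>; the \<open>1\<close>
  matches the derivative of the factor \<open>s\<close> in the term \<open>\<eta> s / p2\<^sup>2\<close>. In the proofs below,
  the chain rule produces some expression for the derivative of each component, and its equality with the
  right-hand side of the system is a polynomial identity after clearing denominators.\<close>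

lemma s0_carries:
  assumes "a \<in> normalized"
  shows "carries a (s0_params a) (at_params s0 a)"
proof -
  obtain \<eta> \<alpha>0 \<alpha>2 where a: "a = (\<eta>, \<alpha>0, 1 - \<alpha>0 - \<alpha>2, \<alpha>2)"
    using assms by (cases a) (auto simp: normalized_def algebra_simps)
  show ?thesis
  proof (rule carriesI[where \<epsilon> = "-1" and ?f1.0 = "\<lambda>q1 p1 q2 p2 s. q1" and ?f2.0 = "\<lambda>q1 p1 q2 p2 s. p1"
      and ?f3.0 = "\<lambda>q1 p1 q2 p2 s. q2 - 2 * \<alpha>0 / p2 + \<eta> * s / p2\<^sup>2" and ?f4.0 = "\<lambda>q1 p1 q2 p2 s. p2"])
    fix q1 p1 q2 p2 s
    assume s: "s \<noteq> 0" and "at_params s0 a (q1 s, p1 s, q2 s, p2 s, s) \<noteq> None"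
      and sol: "solves_at 1 a (q1, p1, q2, p2) s"
    then have nz: "p2 s \<noteq> 0" by (auto simp: at_params_def a)
    note D = solves_at_derivatives[OF sol[unfolded a]]
    show "solves_at (-1) (s0_params a) (\<lambda>s. q1 s, \<lambda>s. p1 s, \<lambda>s. q2 s - 2 * \<alpha>0 / p2 s + \<eta> * s / (p2 s)\<^sup>2, \<lambda>s. p2 s) s"
      unfolding solves_at_def a s0_params_def split
      by (intro conjI; rule DERIV_cong, (rule derivative_eq_intros D refl | simp add: nz)+)
        (use s nz in \<open>simp_all add: divide_simps\<close>, (algebra)+)
  qed (auto simp: at_params_def a split: if_splits)
qed

lemma s1_carries: "carries a (s1_params a) (at_params s1 a)"
proof -
  obtain \<eta> \<alpha>0 \<alpha>1 \<alpha>2 where a: "a = (\<eta>, \<alpha>0, \<alpha>1, \<alpha>2)" by (cases a)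
  show ?thesis
  proof (rule carriesI[where \<epsilon> = 1 and ?f1.0 = "\<lambda>q1 p1 q2 p2 s. q1"
      and ?f2.0 = "\<lambda>q1 p1 q2 p2 s. p1 + \<alpha>1 * q2 / (q1 * q2 + 1)"
      and ?f3.0 = "\<lambda>q1 p1 q2 p2 s. q2" and ?f4.0 = "\<lambda>q1 p1 q2 p2 s. p2 + \<alpha>1 * q1 / (q1 * q2 + 1)"])
    fix q1 p1 q2 p2 s
    assume s: "s \<noteq> 0" and "at_params s1 a (q1 s, p1 s, q2 s, p2 s, s) \<noteq> None"
      and sol: "solves_at 1 a (q1, p1, q2, p2) s"
    then have nz: "q1 s * q2 s + 1 \<noteq> 0" by (auto simp: at_params_def a)
    note D = solves_at_derivatives[OF sol[unfolded a]]
    show "solves_at 1 (s1_params a) (\<lambda>s. q1 s, \<lambda>s. p1 s + \<alpha>1 * q2 s / (q1 s * q2 s + 1), \<lambda>s. q2 s,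
        \<lambda>s. p2 s + \<alpha>1 * q1 s / (q1 s * q2 s + 1)) s"
      unfolding solves_at_def a s1_params_def split
      by (intro conjI; rule DERIV_cong, (rule derivative_eq_intros D refl | simp add: nz)+)
        (use s nz in \<open>simp_all add: divide_simps\<close>, (algebra)+)
  qed (auto simp: at_params_def a split: if_splits)
qed

lemma s2_carries: "carries a (s2_params a) (at_params s2 a)"
proof -
  obtain \<eta> \<alpha>0 \<alpha>1 \<alpha>2 where a: "a = (\<eta>, \<alpha>0, \<alpha>1, \<alpha>2)" by (cases a)
  show ?thesis
  proof (rule carriesI[where \<epsilon> = "-1" and ?f1.0 = "\<lambda>q1 p1 q2 p2 s. - q1 + 2 * \<alpha>2 / p1 + 1 / p1\<^sup>2"
      and ?f2.0 = "\<lambda>q1 p1 q2 p2 s. - p1"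
      and ?f3.0 = "\<lambda>q1 p1 q2 p2 s. - q2" and ?f4.0 = "\<lambda>q1 p1 q2 p2 s. - p2"])
    fix q1 p1 q2 p2 s
    assume s: "s \<noteq> 0" and "at_params s2 a (q1 s, p1 s, q2 s, p2 s, s) \<noteq> None"
      and sol: "solves_at 1 a (q1, p1, q2, p2) s"
    then have nz: "p1 s \<noteq> 0" by (auto simp: at_params_def a)
    note D = solves_at_derivatives[OF sol[unfolded a]]
    show "solves_at (-1) (s2_params a) (\<lambda>s. - q1 s + 2 * \<alpha>2 / p1 s + 1 / (p1 s)\<^sup>2, \<lambda>s. - p1 s, \<lambda>s. - q2 s, \<lambda>s. - p2 s) s"
      unfolding solves_at_def a s2_params_def split
      by (intro conjI; rule DERIV_cong, (rule derivative_eq_intros D refl | simp add: nz)+)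
        (use s nz in \<open>simp_all add: divide_simps\<close>, (algebra)+)
  qed (auto simp: at_params_def a split: if_splits)
qed

text \<open>Differentiating the factor \<open>s\<close> or \<open>1 / s\<close> of a component contributes \<open>1\<close> or
  \<open>-1\<close> to the coefficient of that component's linear term. The coefficient of \<open>q2\<close>,
  for instance, becomes \<open>1 - (\<alpha>1 + \<alpha>2) = \<alpha>0\<close>, which is what the equation for
  \<open>q1\<close> requires after the exchange of \<open>\<alpha>0\<close> and \<open>\<alpha>2\<close>.\<close>

lemma \<pi>_carries:
  assumes "a \<in> normalized"
  shows "carries a (\<pi>_params a) (at_params \<pi> a)"
proof -
  obtain \<eta> \<alpha>0 \<alpha>2 where a: "a = (\<eta>, \<alpha>0, 1 - \<alpha>0 - \<alpha>2, \<alpha>2)"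
    using assms by (cases a) (auto simp: normalized_def algebra_simps)
  show ?thesis
  proof (rule carriesI[where \<epsilon> = 1 and ?f1.0 = "\<lambda>q1 p1 q2 p2 s. - (\<eta> * s * q2)"
      and ?f2.0 = "\<lambda>q1 p1 q2 p2 s. - (p2 / (\<eta> * s))"
      and ?f3.0 = "\<lambda>q1 p1 q2 p2 s. - (q1 / (\<eta> * s))" and ?f4.0 = "\<lambda>q1 p1 q2 p2 s. - (\<eta> * s * p1)"])
    fix q1 p1 q2 p2 s
    assume s: "s \<noteq> 0" and "at_params \<pi> a (q1 s, p1 s, q2 s, p2 s, s) \<noteq> None"
      and sol: "solves_at 1 a (q1, p1, q2, p2) s"
    then have nz: "\<eta> \<noteq> 0" by (auto simp: at_params_def a)
    note D = solves_at_derivatives[OF sol[unfolded a]]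
    show "solves_at 1 (\<pi>_params a) (\<lambda>s. - (\<eta> * s * q2 s), \<lambda>s. - (p2 s / (\<eta> * s)), \<lambda>s. - (q1 s / (\<eta> * s)), \<lambda>s. - (\<eta> * s * p1 s)) s"
      unfolding solves_at_def a \<pi>_params_def split
      by (intro conjI; rule DERIV_cong, (rule derivative_eq_intros D refl | simp add: nz s)+)
        (use s nz in \<open>simp_all add: divide_simps\<close>, (algebra)+)
  qed (auto simp: at_params_def a split: if_splits)
qed

section \<open>Braid relations and the diagram automorphism\<close>

text \<open>
  The common core of the two braid relations of length four. Here \<open>x\<close> is the coordinate that both generators
  fix, up to sign; one generator adds \<open>- 2 a / p + k / p\<^sup>2\<close> to \<open>y\<close> and changes the sign
  of \<open>k\<close>, and the other is \<open>s1\<close>, adding multiples of \<open>x\<close> to \<open>p\<close> and of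
  \<open>y\<close> to \<open>r\<close>. The hypotheses \<open>L\<close> start with the latter and \<open>R\<close> with the former.

  The essential case is \<open>x \<noteq> 0\<close>. There the action on the pair formed by
  \<open>x y + 1\<close> and \<open>p\<close> closes up, and all intermediate values factor into five
  polynomials \<open>u, A, B, C, E\<close>; both sides end at \<open>x y + 1 = B C / E\<^sup>2\<close> and
  \<open>p = A E / C\<close>. The coordinate \<open>r\<close> follows from \<open>p\<close>: by partial
  fractions, each step changes it by \<open>(c - \<Delta>p / x) / x\<close>, where \<open>c\<close> is the
  parameter of the step, and the parameters have the same sum \<open>2 a + 2 b\<close> on both sides.
\<close>

lemma braid_identity:
  fixes x y p r a b k :: complex
  assumes nz: "x * y + 1 \<noteq> 0" "P1 \<noteq> 0" "x * Y1 + 1 \<noteq> 0" "P2 \<noteq> 0"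
    "p \<noteq> 0" "x * Z1 + 1 \<noteq> 0" "S1 \<noteq> 0" "x * Z2 + 1 \<noteq> 0"
  and L: "P1 = p + b * x / (x * y + 1)" "R1 = r + b * y / (x * y + 1)"
    "Y1 = y - 2 * (a + b) / P1 + k / P1\<^sup>2"
    "P2 = P1 + (b + 2 * a) * x / (x * Y1 + 1)" "R2 = R1 + (b + 2 * a) * Y1 / (x * Y1 + 1)"
    "Y2 = Y1 - 2 * a / P2 - k / P2\<^sup>2"
  and R: "Z1 = y - 2 * a / p + k / p\<^sup>2"
    "S1 = p + (b + 2 * a) * x / (x * Z1 + 1)" "T1 = r + (b + 2 * a) * Z1 / (x * Z1 + 1)"
    "Z2 = Z1 - 2 * (a + b) / S1 - k / S1\<^sup>2"
    "S2 = S1 + b * x / (x * Z2 + 1)" "T2 = T1 + b * Z2 / (x * Z2 + 1)"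
  shows "Y2 = Z2 \<and> P2 = S2 \<and> R2 = T2"
proof (cases "x = 0")
  case True
  then show ?thesis
    unfolding L R by (simp add: algebra_simps add_divide_distrib diff_divide_distrib)
next
  case False
  define u where "u = x * y + 1"
  define A where "A = u * p + b * x"
  define B where "B = u * p\<^sup>2 - 2 * a * x * p + k * x"
  define C where "C = A\<^sup>2 - 2 * (a + b) * x * A + k * x * u"
  define E where "E = p * A + k * x"
  have u0: "u \<noteq> 0" using nz u_def by simp
  have P1: "P1 = A / u" using u0 unfolding L A_def u_def by (simp add: field_simps)
  have A0: "A \<noteq> 0" using P1 nz by auto
  have Y1: "x * Y1 + 1 = u * C / A\<^sup>2"
    unfolding L(3) P1 C_def using u0 A0 by (simp add: field_simps power2_eq_square) (simp add: u_def algebra_simps)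
  have C0: "C \<noteq> 0" using Y1 nz by auto
  have CE: "C + (b + 2 * a) * x * A = u * E"
    unfolding C_def E_def A_def u_def by algebra
  have P2: "P2 = A * E / C"
  proof -
    have "P2 = A * (C + (b + 2 * a) * x * A) / (u * C)"
      unfolding L(4) Y1 P1 using u0 A0 C0 by (simp add: field_simps power2_eq_square)
    then show ?thesis using CE u0 C0 by simp
  qed
  have E0: "E \<noteq> 0" using P2 nz by auto
  have Z1: "x * Z1 + 1 = B / p\<^sup>2"
    unfolding R(1) B_def u_def using nz by (simp add: field_simps power2_eq_square)
  have B0: "B \<noteq> 0" using Z1 nz by auto
  have BE: "B + (b + 2 * a) * x * p = E"
    unfolding B_def E_def A_def u_def by algebra
  have S1: "S1 = p * E / B"
    unfolding R(2) Z1 BE[symmetric] using nz B0 by (simp add: field_simps power2_eq_square)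
  have *: "E\<^sup>2 - 2 * (a + b) * x * p * E - k * x * B = p\<^sup>2 * C"
    unfolding B_def E_def C_def A_def u_def by algebra
  have Z2: "x * Z2 + 1 = B * C / E\<^sup>2"
  proof -
    have "x * Z2 + 1 = (x * Z1 + 1) - 2 * (a + b) * x / S1 - k * x / S1\<^sup>2"
      unfolding R(4) by (simp add: algebra_simps)
    also have "\<dots> = B * (E\<^sup>2 - 2 * (a + b) * x * p * E - k * x * B) / (p\<^sup>2 * E\<^sup>2)"
      unfolding Z1 S1 using nz E0 B0 by (simp add: field_simps power2_eq_square)
    finally show ?thesis unfolding * using nz by simp
  qed
  have **: "p * C + b * x * E = A * B"
    unfolding B_def E_def C_def A_def u_def by algebra
  have S2: "S2 = A * E / C"
  proof -
    have "S2 = E * (p * C + b * x * E) / (B * C)"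
      unfolding R(5) Z2 S1 using E0 B0 C0 by (simp add: field_simps power2_eq_square)
    then show ?thesis unfolding ** using B0 by simp
  qed
  have ***: "u * E\<^sup>2 - 2 * a * x * A * E - k * x * C = A\<^sup>2 * B" 
    unfolding B_def E_def C_def A_def u_def by algebra
  have Y2: "x * Y2 + 1 = B * C / E\<^sup>2"
  proof -
    have "x * Y2 + 1 = (x * Y1 + 1) - 2 * a * x / P2 - k * x / P2\<^sup>2"
      unfolding L(6) by (simp add: algebra_simps)
    also have "\<dots> = C * (u * E\<^sup>2 - 2 * a * x * A * E - k * x * C) / (A\<^sup>2 * E\<^sup>2)"
      unfolding Y1 P2 using A0 E0 C0 by (simp add: field_simps power2_eq_square)
    finally show ?thesis unfolding *** using A0 by simp
  qed
  have Y: "Y2 = Z2" using Y2 Z2 False by (metis add_right_cancel mult_left_cancel)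
  \<comment> \<open>Partial fractions: the increment of \<open>r\<close> in terms of that of \<open>p\<close>.\<close>
  have step: "c * z / u = c / x - (c * x / u) / x\<^sup>2" if "u = x * z + 1" "u \<noteq> 0" for c z u
  proof -
    have "c / x - (c * x / u) / x\<^sup>2 = c * (u - 1) / (x * u)"
      using that(2) False by (simp add: field_simps power2_eq_square)
    then show ?thesis using that(1) False by simp
  qed
  have "R2 = r + (2 * a + 2 * b) / x - (P2 - p) / x\<^sup>2"
    unfolding L(2,5,4,1) step[OF refl nz(1)] step[OF refl nz(3)] by (simp add: add_divide_distrib diff_divide_distrib)
  moreover have "T2 = r + (2 * a + 2 * b) / x - (S2 - p) / x\<^sup>2"
    unfolding R(3,6,2,5) step[OF refl nz(6)] step[OF refl nz(8)] by (simp add: add_divide_distrib diff_divide_distrib)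
  ultimately show ?thesis using Y P2 S2 by simp
qed


text \<open>Here \<open>x = q1\<close>, \<open>y = q2\<close>, \<open>p = p2\<close>, \<open>r = p1\<close> and \<open>k = \<eta> s\<close>,
  whose sign changes because \<open>s0\<close> sends \<open>s\<close> to \<open>-s\<close>.\<close>

lemma s0_s1_braid:
  assumes "power_map (s0 \<circ>\<^sub>m s1) 2 x = Some y" "power_map (s1 \<circ>\<^sub>m s0) 2 x = Some z"
  shows "y = z"
proof (cases x rule: s0.cases)
  case (1 q1 p1 q2 p2 s \<eta> \<alpha>0 \<alpha>1 \<alpha>2)
  obtain x1 x2 x3 where x: "s1 x = Some x1" "s0 x1 = Some x2" "s1 x2 = Some x3" "s0 x3 = Some y"
    using assms(1) by (auto simp: numeral_2_eq_2 map_comp_def split: option.splits)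
  obtain z1 z2 z3 where z: "s0 x = Some z1" "s1 z1 = Some z2" "s0 z2 = Some z3" "s1 z3 = Some z"
    using assms(2) by (auto simp: numeral_2_eq_2 map_comp_def split: option.splits)
  define P1 where "P1 = p2 + \<alpha>1 * q1 / (q1 * q2 + 1)"
  define R1 where "R1 = p1 + \<alpha>1 * q2 / (q1 * q2 + 1)"
  define Y1 where "Y1 = q2 - 2 * (\<alpha>0 + \<alpha>1) / P1 + (\<eta> * s) / P1\<^sup>2"
  define P2 where "P2 = P1 + (\<alpha>1 + 2 * \<alpha>0) * q1 / (q1 * Y1 + 1)"
  define R2 where "R2 = R1 + (\<alpha>1 + 2 * \<alpha>0) * Y1 / (q1 * Y1 + 1)"
  define Y2 where "Y2 = Y1 - 2 * \<alpha>0 / P2 - (\<eta> * s) / P2\<^sup>2"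
  have x1: "x1 = ((q1, R1, q2, P1, s), \<eta>, \<alpha>0 + \<alpha>1, - \<alpha>1, \<alpha>2 + \<alpha>1)" "q1 * q2 + 1 \<noteq> 0"
    using x(1) by (auto simp: 1 R1_def P1_def split: if_splits)
  have x2: "x2 = ((q1, R1, Y1, P1, - s), \<eta>, - (\<alpha>0 + \<alpha>1), \<alpha>1 + 2 * \<alpha>0, \<alpha>2 + \<alpha>1)" "P1 \<noteq> 0"
    using x(2) by (auto simp: x1 Y1_def split: if_splits)
  have x3: "x3 = ((q1, R2, Y1, P2, - s), \<eta>, \<alpha>0, - (\<alpha>1 + 2 * \<alpha>0), \<alpha>2 + 2 * \<alpha>1 + 2 * \<alpha>0)" "q1 * Y1 + 1 \<noteq> 0"
    using x(3) by (auto simp: x2 P2_def R2_def split: if_splits)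
  have y: "y = ((q1, R2, Y2, P2, s), \<eta>, - \<alpha>0, - \<alpha>1, \<alpha>2 + 2 * \<alpha>1 + 2 * \<alpha>0)" "P2 \<noteq> 0"
    using x(4) by (auto simp: x3 Y2_def split: if_splits)
  define Z1 where "Z1 = q2 - 2 * \<alpha>0 / p2 + (\<eta> * s) / p2\<^sup>2"
  define S1 where "S1 = p2 + (\<alpha>1 + 2 * \<alpha>0) * q1 / (q1 * Z1 + 1)"
  define T1 where "T1 = p1 + (\<alpha>1 + 2 * \<alpha>0) * Z1 / (q1 * Z1 + 1)"
  define Z2 where "Z2 = Z1 - 2 * (\<alpha>0 + \<alpha>1) / S1 - (\<eta> * s) / S1\<^sup>2"
  define S2 where "S2 = S1 + \<alpha>1 * q1 / (q1 * Z2 + 1)"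
  define T2 where "T2 = T1 + \<alpha>1 * Z2 / (q1 * Z2 + 1)"
  have z1: "z1 = ((q1, p1, Z1, p2, - s), \<eta>, - \<alpha>0, \<alpha>1 + 2 * \<alpha>0, \<alpha>2)" "p2 \<noteq> 0"
    using z(1) by (auto simp: 1 Z1_def split: if_splits)
  have z2: "z2 = ((q1, T1, Z1, S1, - s), \<eta>, \<alpha>0 + \<alpha>1, - (\<alpha>1 + 2 * \<alpha>0), \<alpha>2 + \<alpha>1 + 2 * \<alpha>0)" "q1 * Z1 + 1 \<noteq> 0"
    using z(2) by (auto simp: z1 S1_def T1_def split: if_splits)
  have z3: "z3 = ((q1, T1, Z2, S1, s), \<eta>, - (\<alpha>0 + \<alpha>1), \<alpha>1, \<alpha>2 + \<alpha>1 + 2 * \<alpha>0)" "S1 \<noteq> 0"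
    using z(3) by (auto simp: z2 Z2_def split: if_splits)
  have zz: "z = ((q1, T2, Z2, S2, s), \<eta>, - \<alpha>0, - \<alpha>1, \<alpha>2 + 2 * \<alpha>1 + 2 * \<alpha>0)" "q1 * Z2 + 1 \<noteq> 0"
    using z(4) by (auto simp: z3 T2_def S2_def split: if_splits)
  have "Y2 = Z2 \<and> P2 = S2 \<and> R2 = T2"
    by (rule braid_identity[OF x1(2) x2(2) x3(2) y(2) z1(2) z2(2) z3(2) zz(2) P1_def R1_def Y1_def
          P2_def R2_def Y2_def Z1_def S1_def T1_def Z2_def S2_def T2_def])
  then show ?thesis by (simp add: y zz)
qed

text \<open>Here the indices 1 and 2 are exchanged and \<open>k = -1\<close>. Up to the common sign change of
  \<open>q1, p1, q2, p2\<close>, which commutes with \<open>s1\<close>, the map \<open>s2\<close> is \<open>q1 \<mapsto> q1 - 2 \<alpha>2 / p1 - 1 / p1\<^sup>2\<close>.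
  After one sign change the last term reads \<open>+ 1 / p1\<^sup>2\<close> in the original coordinates, which is the alternation
  of \<open>k\<close>. The intermediate points carry the sign explicitly.\<close>

lemma s1_s2_braid:
  assumes "power_map (s1 \<circ>\<^sub>m s2) 2 x = Some z" "power_map (s2 \<circ>\<^sub>m s1) 2 x = Some y"
  shows "z = y"
proof (cases x rule: s0.cases)
  case (1 q1 p1 q2 p2 s \<eta> \<alpha>0 \<alpha>1 \<alpha>2)
  obtain x1 x2 x3 where x: "s1 x = Some x1" "s2 x1 = Some x2" "s1 x2 = Some x3" "s2 x3 = Some y"
    using assms(2) by (auto simp: numeral_2_eq_2 map_comp_def split: option.splits)
  obtain z1 z2 z3 where z: "s2 x = Some z1" "s1 z1 = Some z2" "s2 z2 = Some z3" "s1 z3 = Some z"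
    using assms(1) by (auto simp: numeral_2_eq_2 map_comp_def split: option.splits)
  define P1 where "P1 = p1 + \<alpha>1 * q2 / (q2 * q1 + 1)"
  define R1 where "R1 = p2 + \<alpha>1 * q1 / (q2 * q1 + 1)"
  define Y1 where "Y1 = q1 - 2 * (\<alpha>2 + \<alpha>1) / P1 + (- 1) / P1\<^sup>2"
  define P2 where "P2 = P1 + (\<alpha>1 + 2 * \<alpha>2) * q2 / (q2 * Y1 + 1)"
  define R2 where "R2 = R1 + (\<alpha>1 + 2 * \<alpha>2) * Y1 / (q2 * Y1 + 1)"
  define Y2 where "Y2 = Y1 - 2 * \<alpha>2 / P2 - (- 1) / P2\<^sup>2"
  have x1: "x1 = ((q1, P1, q2, R1, s), \<eta>, \<alpha>0 + \<alpha>1, - \<alpha>1, \<alpha>2 + \<alpha>1)" "q2 * q1 + 1 \<noteq> 0"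
    using x(1) by (auto simp: 1 R1_def P1_def mult.commute split: if_splits)
  have x2: "x2 = ((- Y1, - P1, - q2, - R1, - s), \<eta>, \<alpha>0 + \<alpha>1, \<alpha>1 + 2 * \<alpha>2, - (\<alpha>2 + \<alpha>1))" "P1 \<noteq> 0"
    using x(2) by (auto simp: x1 Y1_def split: if_splits)
  have x3: "x3 = ((- Y1, - P2, - q2, - R2, - s), \<eta>, \<alpha>0 + 2 * \<alpha>1 + 2 * \<alpha>2, - (\<alpha>1 + 2 * \<alpha>2), \<alpha>2)"
    "q2 * Y1 + 1 \<noteq> 0"
    using x(3) by (auto simp: x2 P2_def R2_def mult.commute split: if_splits)
  have y: "y = ((Y2, P2, q2, R2, s), \<eta>, \<alpha>0 + 2 * \<alpha>1 + 2 * \<alpha>2, - \<alpha>1, - \<alpha>2)" "P2 \<noteq> 0"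
    using x(4) by (auto simp: x3 Y2_def split: if_splits)
  define Z1 where "Z1 = q1 - 2 * \<alpha>2 / p1 + (- 1) / p1\<^sup>2"
  define S1 where "S1 = p1 + (\<alpha>1 + 2 * \<alpha>2) * q2 / (q2 * Z1 + 1)"
  define T1 where "T1 = p2 + (\<alpha>1 + 2 * \<alpha>2) * Z1 / (q2 * Z1 + 1)"
  define Z2 where "Z2 = Z1 - 2 * (\<alpha>2 + \<alpha>1) / S1 - (- 1) / S1\<^sup>2"
  define S2 where "S2 = S1 + \<alpha>1 * q2 / (q2 * Z2 + 1)"
  define T2 where "T2 = T1 + \<alpha>1 * Z2 / (q2 * Z2 + 1)"
  have z1: "z1 = ((- Z1, - p1, - q2, - p2, - s), \<eta>, \<alpha>0, \<alpha>1 + 2 * \<alpha>2, - \<alpha>2)" "p1 \<noteq> 0"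
    using z(1) by (auto simp: 1 Z1_def split: if_splits)
  have z2: "z2 = ((- Z1, - S1, - q2, - T1, - s), \<eta>, \<alpha>0 + \<alpha>1 + 2 * \<alpha>2, - (\<alpha>1 + 2 * \<alpha>2), \<alpha>2 + \<alpha>1)"
    "q2 * Z1 + 1 \<noteq> 0"
    using z(2) by (auto simp: z1 S1_def T1_def mult.commute split: if_splits)
  have z3: "z3 = ((Z2, S1, q2, T1, s), \<eta>, \<alpha>0 + \<alpha>1 + 2 * \<alpha>2, \<alpha>1, - (\<alpha>2 + \<alpha>1))" "S1 \<noteq> 0"
    using z(3) by (auto simp: z2 Z2_def split: if_splits)
  have zz: "z = ((Z2, S2, q2, T2, s), \<eta>, \<alpha>0 + 2 * \<alpha>1 + 2 * \<alpha>2, - \<alpha>1, - \<alpha>2)" "q2 * Z2 + 1 \<noteq> 0"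
    using z(4) by (auto simp: z3 T2_def S2_def mult.commute split: if_splits)
  have "Y2 = Z2 \<and> P2 = S2 \<and> R2 = T2"
    by (rule braid_identity[OF x1(2) x2(2) x3(2) y(2) z1(2) z2(2) z3(2) zz(2) P1_def R1_def Y1_def
          P2_def R2_def Y2_def Z1_def S1_def T1_def Z2_def S2_def T2_def])
  then show ?thesis by (simp add: y zz)
qed

lemma s0_s2_commute: "s0 \<circ>\<^sub>m s2 = s2 \<circ>\<^sub>m s0"
proof
  show "(s0 \<circ>\<^sub>m s2) x = (s2 \<circ>\<^sub>m s0) x" for x
    by (cases x rule: s0.cases) (simp add: map_comp_def)
qed

lemma \<pi>_s0: "\<pi> \<circ>\<^sub>m s0 = s2 \<circ>\<^sub>m \<pi>"
proof
  show "(\<pi> \<circ>\<^sub>m s0) x = (s2 \<circ>\<^sub>m \<pi>) x" for x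
    by (cases x rule: s0.cases) (simp add: map_comp_def field_simps power2_eq_square)
qed

lemma \<pi>_s1: "\<pi> \<circ>\<^sub>m s1 = s1 \<circ>\<^sub>m \<pi>"
proof
  show "(\<pi> \<circ>\<^sub>m s1) x = (s1 \<circ>\<^sub>m \<pi>) x" for x
  proof (cases x rule: s0.cases)
    case (1 q1 p1 q2 p2 s \<eta> \<alpha>0 \<alpha>1 \<alpha>2)
    have "\<eta> * s * q2 * (q1 / (\<eta> * s)) + 1 = q1 * q2 + 1" if "\<eta> * s \<noteq> 0"
      using that by simp
    then show ?thesis unfolding 1
      by (cases "\<eta> * s = 0"; cases "q1 * q2 + 1 = 0")
        (auto simp add: map_comp_def divide_simps, (simp_all add: algebra_simps)?)
  qed
qed

section \<open>The extended affine Weyl group symmetry\<close>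

theorem theorem4p4:
  shows
    "Backlund normalized s0 \<and>
     Backlund normalized s1 \<and>
     Backlund normalized s2 \<and>
     Backlund (normalized \<inter> nonzero_eta) \<pi> \<and>
     rat_eq normalized (power_map s0 2) Some \<and>
     rat_eq normalized (power_map s1 2) Some \<and>
     rat_eq normalized (power_map s2 2) Some \<and>
     rat_eq normalized (power_map (s0 \<circ>\<^sub>m s2) 2) Some \<and>
     rat_eq normalized (power_map (s0 \<circ>\<^sub>m s1) 4) Some \<and>
     rat_eq normalized (power_map (s1 \<circ>\<^sub>m s2) 4) Some \<and>
     rat_eq (normalized \<inter> nonzero_eta) (power_map \<pi> 2) Some \<and>
     rat_eq (normalized \<inter> nonzero_eta) (\<pi> \<circ>\<^sub>m s0) (s2 \<circ>\<^sub>m \<pi>) \<and>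
     rat_eq (normalized \<inter> nonzero_eta) (\<pi> \<circ>\<^sub>m s1) (s1 \<circ>\<^sub>m \<pi>)"
proof -
  let ?N = "normalized" and ?E = "normalized \<inter> nonzero_eta"
  have N: "s0_params a \<in> ?N" "s1_params a \<in> ?N" "s2_params a \<in> ?N" if "a \<in> ?N" for a
    using that by (auto simp: normalized_def s0_params_def s1_params_def s2_params_def algebra_simps)
  have E: "s0_params a \<in> ?E" "s1_params a \<in> ?E" "\<pi>_params a \<in> ?E" if "a \<in> ?E" for a
    using that by (auto simp: normalized_def nonzero_eta_def s0_params_def s1_params_def
        \<pi>_params_def algebra_simps)
  note invN = s0_birational_involution[of ?N, OF N(1)] s1_birational_involution[of ?N, OF N(2)]
    s2_birational_involution[of ?N, OF N(3)]
  note inv\<pi> = \<pi>_birational_involution[of ?E, OF E(3) Int_lower2]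
  note domN = invN[THEN birational_involution_dominant]
  note domE = s0_birational_involution[of ?E, OF E(1), THEN birational_involution_dominant]
    s1_birational_involution[of ?E, OF E(2), THEN birational_involution_dominant]
    inv\<pi>[THEN birational_involution_dominant]
  have "rat_eq ?N (power_map (s0 \<circ>\<^sub>m s2) 2) Some"
    unfolding one_add_one[symmetric]
  proof (rule order_from_braid[OF s0_involutive s2_involutive domN(1,3)])
    show "y = z" if "power_map (s0 \<circ>\<^sub>m s2) 1 x = Some y" "power_map (s2 \<circ>\<^sub>m s0) 1 x = Some z" for x y z
      using that by (simp add: s0_s2_commute)
  qed
  moreover have "rat_eq ?N (power_map (s0 \<circ>\<^sub>m s1) (2 + 2)) Some"
    by (rule order_from_braid[OF s0_involutive s1_involutive domN(1,2) s0_s1_braid])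
  moreover have "rat_eq ?N (power_map (s1 \<circ>\<^sub>m s2) (2 + 2)) Some"
    by (rule order_from_braid[OF s1_involutive s2_involutive domN(2,3) s1_s2_braid])
  moreover have "rat_eq ?E (\<pi> \<circ>\<^sub>m s0) (s2 \<circ>\<^sub>m \<pi>)" "rat_eq ?E (\<pi> \<circ>\<^sub>m s1) (s1 \<circ>\<^sub>m \<pi>)"
    using rat_eq_if_dominant[OF dominant_comp[OF domE(3,1)]]
      rat_eq_if_dominant[OF dominant_comp[OF domE(3,2)]] by (simp_all add: \<pi>_s0 \<pi>_s1)
  ultimately show ?thesis
    using rat_eq_involutive[OF s0_involutive domN(1)] rat_eq_involutive[OF s1_involutive domN(2)]
      rat_eq_involutive[OF s2_involutive domN(3)] rat_eq_involutive[OF \<pi>_involutive domE(3)]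
      BacklundI[OF invN(1) s0_carries] BacklundI[OF invN(2) s1_carries]
      BacklundI[OF invN(3) s2_carries] BacklundI[OF inv\<pi> \<pi>_carries]
    by simp
qed

end
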